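(* Let $K(a_{n,k})$ be a Köthe space, let $\beta$ be a non-negative increasing sequence tending to infinity, and let $\theta=(\theta_n)_{n\in\mathbb{N}_0}\in\Lambda_\infty(\beta)$. Assume that for every $k\in\mathbb{N}$ there exist $m\in\mathbb{N}$ and $C>0$ such that $$e^{-k\beta_n}\le C\,a_{n,m}\qquad\text{for all }n\in\mathbb{N}.$$ Then the Hankel operator $H_\theta:K(a_{n,k})\to\Lambda_\infty(\beta)$ is well-defined and continuous.
   Context: $\mathbb{N}=\{1,2,\dots\}$, $\mathbb{N}_0=\mathbb{N}\cup\{0\}$. A Köthe matrix is a matrix $(a_{n,k})_{n,k\in\mathbb{N}}$ of non-negative numbers such that for each $n$ there is $k$ with $a_{n,k}>0$, and $a_{n,k}\le a_{n,k+1}$ for all $n,k$. The associated Köthe space is the Fréchet space $K(a_{n,k})=\{x=(x_n)_{n\in\mathbb{N}}:\ \|x\|_k:=\sum_{n=1}^\infty|x_n|a_{n,k}<\infty\ \text{for all }k\in\mathbb{N}\}$ with seminorms $\|\cdot\|_k$, $k\in\mathbb{N}$. For a non-negative increasing sequence $\beta=(\beta_n)_{n\in\mathbb{N}}$ with $\beta_n\to\infty$, the power series space of infinite type is $\Lambda_\infty(\beta)=K(e^{k\beta_n})$, i.e. $\|x\|_k=\sum_{n=1}^\infty|x_n|e^{k\beta_n}$. The sequence $e_n$ has $1$ in the $n$-th place and $0$ elsewhere. A sequence $\theta=(\theta_n)_{n\in\mathbb{N}_0}$ is identified with the sequence $(\theta_{n-1})_{n\in\mathbb{N}}=(\theta_0,\theta_1,\theta_2,\dots)$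 when it is said to belong to a sequence space. The Hankel operator $H_\theta$ from a Köthe space $E$ to a Köthe space $F$ is given by $H_\theta e_n=(\theta_{n-1},\theta_n,\theta_{n+1},\dots)=\sum_{j=1}^\infty\theta_{j+n-2}e_j$ for $n\in\mathbb{N}$ and $H_\theta x=\sum_{n=1}^\infty x_nH_\theta e_n$ for $x=(x_n)\in E$. It is well-defined if $H_\theta e_n\in F$ for all $n$ and the series $\sum_n x_nH_\theta e_n$ converges in $F$ for every $x\in E$. *)

theory Defs
  imports "HOL-Analysis.Analysis"
begin

text \<open>
  The index set \<open>{1, 2, \<dots>}\<close> of sequences and of seminorms is represented by \<^typ>\<open>nat\<close>, with
  \<open>n\<close> standing for the index \<open>n + 1\<close>. Thus \<open>a n k\<close> is the matrix entry \<open>a\<^sub>n\<^sub>+\<^sub>1\<^sub>,\<^sub>k\<^sub>+\<^sub>1\<close>, whereas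
  a sequence \<open>\<theta>\<close> indexed from \<open>0\<close> needs no shift: as a member of a sequence space it is
  \<open>(\<theta> 0, \<theta> 1, \<dots>)\<close>. The scalars form a complete normed field over the reals, i.e. the real or
  the complex numbers.
\<close>

definition kothe_matrix :: "(nat \<Rightarrow> nat \<Rightarrow> real) \<Rightarrow> bool" where
  "kothe_matrix a \<longleftrightarrow>
     (\<forall>n k. 0 \<le> a n k) \<and> (\<forall>n. \<exists>k. 0 < a n k) \<and> (\<forall>n k. a n k \<le> a n (Suc k))"

definition kothe_space :: "(nat \<Rightarrow> nat \<Rightarrow> real) \<Rightarrow> (nat \<Rightarrow> 'a::{real_normed_field,banach}) set" where
  "kothe_space a = {x. \<forall>k. summable (\<lambda>n. norm (x n) * a n k)}"

definition kothe_seminorm ::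
    "(nat \<Rightarrow> nat \<Rightarrow> real) \<Rightarrow> nat \<Rightarrow> (nat \<Rightarrow> 'a::{real_normed_field,banach}) \<Rightarrow> real" where
  "kothe_seminorm a k x = (\<Sum>n. norm (x n) * a n k)"

text \<open>The locally convex topology of the seminorms: their open balls form a subbase.\<close>

definition kothe_topology ::
    "(nat \<Rightarrow> nat \<Rightarrow> real) \<Rightarrow> (nat \<Rightarrow> 'a::{real_normed_field,banach}) topology" where
  "kothe_topology a = topology_generated_by
     {{y \<in> kothe_space a. kothe_seminorm a k (\<lambda>n. y n - x n) < r} | x k r.
        x \<in> kothe_space a \<and> 0 < r}"

lemma topspace_kothe_topology: "topspace (kothe_topology a) = kothe_space a"
proof (intro equalityI subsetI)
  fix y :: "nat \<Rightarrow> 'a"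
  assume y: "y \<in> kothe_space a"
  let ?B = "{z \<in> kothe_space a. kothe_seminorm a 0 (\<lambda>n. z n - y n) < 1}"
  have "openin (kothe_topology a) ?B"
    unfolding kothe_topology_def
    by (rule topology_generated_by_Basis, rule CollectI,
        rule exI[of _ y], rule exI[of _ 0], rule exI[of _ 1]) (use y in simp)
  moreover have "y \<in> ?B"
    using y by (simp add: kothe_seminorm_def)
  ultimately show "y \<in> topspace (kothe_topology a)"
    using openin_subset by blast
qed (auto simp: kothe_topology_def topology_generated_by_topspace)

text \<open>The matrix whose Koethe space is the power series space of infinite type given by \<open>\<beta>\<close>;
  the exponent \<open>k + 1\<close> is the index shift.\<close>

definition power_series_matrix :: "(nat \<Rightarrow> real) \<Rightarrow> nat \<Rightarrow> nat \<Rightarrow> real" where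
  "power_series_matrix \<beta> n k = exp (real (Suc k) * \<beta> n)"

text \<open>\<open>hankel_column \<theta> n\<close> is the image of the unit vector with \<open>1\<close> in position \<open>n\<close> (counted from
  \<open>0\<close>), the sequence \<open>(\<theta> n, \<theta> (n + 1), \<dots>)\<close>.\<close>

definition hankel_column :: "(nat \<Rightarrow> 'a) \<Rightarrow> nat \<Rightarrow> nat \<Rightarrow> 'a" where
  "hankel_column \<theta> n = (\<lambda>j. \<theta> (n + j))"

definition hankel_partial_sum ::
    "(nat \<Rightarrow> 'a) \<Rightarrow> (nat \<Rightarrow> 'a) \<Rightarrow> nat \<Rightarrow> nat \<Rightarrow> 'a::{real_normed_field,banach}" where
  "hankel_partial_sum \<theta> x N = (\<lambda>j. \<Sum>n<N. x n * hankel_column \<theta> n j)"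

definition hankel_well_defined ::
    "(nat \<Rightarrow> nat \<Rightarrow> real) \<Rightarrow> (nat \<Rightarrow> nat \<Rightarrow> real) \<Rightarrow> (nat \<Rightarrow> 'a::{real_normed_field,banach}) \<Rightarrow> bool" where
  "hankel_well_defined a b \<theta> \<longleftrightarrow>
     (\<forall>n. hankel_column \<theta> n \<in> kothe_space b) \<and>
     (\<forall>x\<in>kothe_space a. \<exists>y. limitin (kothe_topology b) (hankel_partial_sum \<theta> x) y sequentially)"

text \<open>The sum of the series in the target space of \<open>b\<close>; limits there are unique when \<open>b\<close> is a
  Koethe matrix, and the value is meaningful only where the series converges.\<close>

definition hankel_operator ::
    "(nat \<Rightarrow> nat \<Rightarrow> real) \<Rightarrow> (nat \<Rightarrow> 'a) \<Rightarrow> (nat \<Rightarrow> 'a) \<Rightarrow> nat \<Rightarrow> 'a::{real_normed_field,banach}" where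
  "hankel_operator b \<theta> x =
     (THE y. limitin (kothe_topology b) (hankel_partial_sum \<theta> x) y sequentially)"

end

theory Submission
  imports Defs
begin

text \<open>
  Since \<open>\<beta>\<close> is increasing, \<open>exp (k \<beta>\<^sub>j) \<le> exp (- \<beta>\<^sub>n) exp ((k + 1) \<beta>\<^sub>n\<^sub>+\<^sub>j)\<close>, so the \<open>k\<close>-th seminorm
  of the \<open>n\<close>-th column of the Hankel matrix is at most \<open>exp (- \<beta>\<^sub>n)\<close> times the seminorm of \<open>\<theta>\<close> of
  index \<open>k + 1\<close>. By hypothesis this is dominated by a multiple of \<open>a\<^sub>n\<^sub>,\<^sub>m\<close>, with \<open>m\<close> independent
  of \<open>k\<close>. A matrix whose columns satisfy such estimates maps \<open>K(a)\<close> continuously into the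
  target by the triangle inequality and an exchange of summations.
\<close>

section \<open>Seminorms and convergence in Koethe spaces\<close>

lemma kothe_matrix_nonneg: "kothe_matrix a \<Longrightarrow> 0 \<le> a n k"
  by (simp add: kothe_matrix_def)

lemma kothe_space_summable: "x \<in> kothe_space a \<Longrightarrow> summable (\<lambda>n. norm (x n) * a n k)"
  by (simp add: kothe_space_def)

lemma kothe_seminorm_nonneg:
  assumes "kothe_matrix a" "x \<in> kothe_space a"
  shows "0 \<le> kothe_seminorm a k x"
  unfolding kothe_seminorm_def
  using assms by (intro suminf_nonneg kothe_space_summable) (auto simp: kothe_matrix_nonneg)

lemma kothe_seminorm_minus_commute:
  "kothe_seminorm a k (\<lambda>n. x n - y n) = kothe_seminorm a k (\<lambda>n. y n - x n)"
  by (simp add: kothe_seminorm_def norm_minus_commute)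

lemma kothe_space_add:
  assumes "kothe_matrix a" "x \<in> kothe_space a" "y \<in> kothe_space a"
  shows "(\<lambda>n. x n + y n) \<in> kothe_space a"
  unfolding kothe_space_def
proof (intro CollectI allI)
  fix k
  show "summable (\<lambda>n. norm (x n + y n) * a n k)"
  proof (rule summable_comparison_test')
    show "summable (\<lambda>n. norm (x n) * a n k + norm (y n) * a n k)"
      using assms by (intro summable_add kothe_space_summable)
    show "norm (norm (x n + y n) * a n k) \<le> norm (x n) * a n k + norm (y n) * a n k" for n
      using mult_right_mono[OF norm_triangle_ineq, of "a n k" "x n" "y n"] assms(1)
      by (simp add: kothe_matrix_nonneg distrib_right)
  qed
qed

lemma kothe_seminorm_triangle:
  assumes "kothe_matrix a" "x \<in> kothe_space a" "y \<in> kothe_space a"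
  shows "kothe_seminorm a k (\<lambda>n. x n + y n) \<le> kothe_seminorm a k x + kothe_seminorm a k y"
proof -
  have "kothe_seminorm a k (\<lambda>n. x n + y n) \<le> (\<Sum>n. norm (x n) * a n k + norm (y n) * a n k)"
    unfolding kothe_seminorm_def
  proof (rule suminf_le)
    show "norm (x n + y n) * a n k \<le> norm (x n) * a n k + norm (y n) * a n k" for n
      using mult_right_mono[OF norm_triangle_ineq, of "a n k" "x n" "y n"] assms(1)
      by (simp add: kothe_matrix_nonneg distrib_right)
    show "summable (\<lambda>n. norm (x n + y n) * a n k)"
      by (rule kothe_space_summable[OF kothe_space_add[OF assms]])
    show "summable (\<lambda>n. norm (x n) * a n k + norm (y n) * a n k)"
      using assms by (intro summable_add kothe_space_summable)
  qed
  then show ?thesis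
    using assms by (simp add: kothe_seminorm_def suminf_add[symmetric] kothe_space_summable)
qed

lemma kothe_space_diff:
  assumes "kothe_matrix a" "x \<in> kothe_space a" "y \<in> kothe_space a"
  shows "(\<lambda>n. x n - y n) \<in> kothe_space a"
proof -
  have "(\<lambda>n. - y n) \<in> kothe_space a"
    using assms(3) by (simp add: kothe_space_def)
  then show ?thesis
    using kothe_space_add[OF assms(1,2)] by fastforce
qed

lemma kothe_seminorm_triangle_diff:
  assumes "kothe_matrix a" "x \<in> kothe_space a" "y \<in> kothe_space a" "z \<in> kothe_space a"
  shows "kothe_seminorm a k (\<lambda>n. x n - z n) \<le>
    kothe_seminorm a k (\<lambda>n. x n - y n) + kothe_seminorm a k (\<lambda>n. y n - z n)"
  using kothe_seminorm_triangle[OF assms(1) kothe_space_diff[OF assms(1,2,3)]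
      kothe_space_diff[OF assms(1,3,4)]] by simp

lemma kothe_space_sum:
  assumes "kothe_matrix a" "\<And>i. i < (N::nat) \<Longrightarrow> f i \<in> kothe_space a"
  shows "(\<lambda>n. \<Sum>i<N. f i n) \<in> kothe_space a"
  using assms(2)
proof (induction N)
  case 0
  show ?case by (simp add: kothe_space_def)
next
  case (Suc N)
  then have "(\<lambda>n. (\<Sum>i<N. f i n) + f N n) \<in> kothe_space a"
    by (intro kothe_space_add[OF assms(1)]) auto
  then show ?case by simp
qed

lemma kothe_space_scale:
  assumes "x \<in> kothe_space a"
  shows "(\<lambda>n. c * x n) \<in> kothe_space a"
  using assms by (auto simp: kothe_space_def norm_mult mult.assoc intro!: summable_mult)

text \<open>One term of a series of non-negative terms is at most its sum. At an index
  \<open>k\<close> with \<open>0 < a n k\<close> this controls the coordinate \<open>x n\<close>,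
  which is how coordinates are recovered from seminorms below.\<close>

lemma kothe_seminorm_component_le:
  assumes "kothe_matrix a" "x \<in> kothe_space a"
  shows "norm (x n) * a n k \<le> kothe_seminorm a k x"
  using sum_le_suminf[OF kothe_space_summable[OF assms(2)], of "{n}" k]
    kothe_matrix_nonneg[OF assms(1)]
  by (simp add: kothe_seminorm_def)

section \<open>The seminorm topology: balls, limits and their uniqueness\<close>

lemma openin_kothe_ball:
  assumes "x \<in> kothe_space a" "0 < r"
  shows "openin (kothe_topology a) {y \<in> kothe_space a. kothe_seminorm a k (\<lambda>n. y n - x n) < r}"
  unfolding kothe_topology_def
  by (rule topology_generated_by_Basis) (use assms in blast)

text \<open>The topology is known only through a subbase of balls with arbitrary centres, so the
  neighbourhoods of \<open>y\<close> are handled by induction on the generation of open sets. The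
  triangle inequality deals with a ball that contains \<open>y\<close> without being centred
  there.\<close>

lemma limitin_kothe_topologyI:
  assumes a: "kothe_matrix a" and y: "y \<in> kothe_space a" and f: "\<And>N. f N \<in> kothe_space a"
    and lim: "\<And>k. (\<lambda>N. kothe_seminorm a k (\<lambda>n. f N n - y n)) \<longlonglongrightarrow> 0"
  shows "limitin (kothe_topology a) f y sequentially"
  unfolding limitin_def
proof (intro conjI allI impI)
  show "y \<in> topspace (kothe_topology a)"
    using y by (simp add: topspace_kothe_topology)
next
  fix U
  assume U: "openin (kothe_topology a) U \<and> y \<in> U"
  then have "generate_topology_on {{y \<in> kothe_space a. kothe_seminorm a k (\<lambda>n. y n - x n) < r} | x k r.
        x \<in> kothe_space a \<and> 0 < r} U"
    by (simp add: kothe_topology_def openin_topology_generated_by_iff)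
  \<comment> \<open>Membership of \<open>y\<close> stays inside the induction claim because a member
    of a union may fail to contain \<open>y\<close>.\<close>
  then have "y \<in> U \<longrightarrow> (\<forall>\<^sub>F N in sequentially. f N \<in> U)"
  proof induction
    case Empty
    then show ?case by simp
  next
    case (Int V W)
    then show ?case by (auto intro: eventually_conj)
  next
    case (UN K)
    show ?case
    proof
      assume "y \<in> \<Union>K"
      then obtain V where "V \<in> K" "\<forall>\<^sub>F N in sequentially. f N \<in> V"
        using UN by blast
      then show "\<forall>\<^sub>F N in sequentially. f N \<in> \<Union>K"
        by (auto elim: eventually_mono)
    qed
  next
    case (Basis V)
    then obtain x k r where V: "V = {y \<in> kothe_space a. kothe_seminorm a k (\<lambda>n. y n - x n) < r}"
      and x: "x \<in> kothe_space a"
      by blast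
    show ?case
    proof
      assume "y \<in> V"
      then have "0 < r - kothe_seminorm a k (\<lambda>n. y n - x n)"
        using V by simp
      from order_tendstoD(2)[OF lim this]
      show "\<forall>\<^sub>F N in sequentially. f N \<in> V"
      proof (rule eventually_mono)
        fix N
        assume "kothe_seminorm a k (\<lambda>n. f N n - y n) < r - kothe_seminorm a k (\<lambda>n. y n - x n)"
        then show "f N \<in> V"
          using kothe_seminorm_triangle_diff[OF a f y x, of k N] f[of N] by (simp add: V)
      qed
    qed
  qed
  then show "\<forall>\<^sub>F N in sequentially. f N \<in> U"
    using U by blast
qed

text \<open>Every coordinate carries a positive weight in some seminorm, so the seminorms separate
  points.\<close>

lemma limitin_kothe_topology_unique:
  assumes a: "kothe_matrix a"
    and y: "limitin (kothe_topology a) f y sequentially"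
    and z: "limitin (kothe_topology a) f z sequentially"
  shows "y = z"
proof
  fix n
  have mem: "y \<in> kothe_space a" "z \<in> kothe_space a"
    using y z by (simp_all add: limitin_def topspace_kothe_topology)
  obtain k where k: "0 < a n k"
    using a unfolding kothe_matrix_def by blast
  have near: "\<forall>\<^sub>F N in sequentially. f N \<in> kothe_space a \<and> kothe_seminorm a k (\<lambda>n. f N n - w n) < e"
    if w: "limitin (kothe_topology a) f w sequentially" "w \<in> kothe_space a" and e: "0 < e" for w e
  proof -
    have "w \<in> {v \<in> kothe_space a. kothe_seminorm a k (\<lambda>n. v n - w n) < e}"
      using w(2) e by (simp add: kothe_seminorm_def)
    then show ?thesis
      using w openin_kothe_ball[OF w(2) e, of k] unfolding limitin_def by fastforce
  qed
  have "norm (y n - z n) * a n k \<le> e" if e: "0 < e" for e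
  proof -
    have "\<forall>\<^sub>F N in sequentially. (f N \<in> kothe_space a \<and> kothe_seminorm a k (\<lambda>n. f N n - y n) < e / 2)
        \<and> (f N \<in> kothe_space a \<and> kothe_seminorm a k (\<lambda>n. f N n - z n) < e / 2)"
      using e by (intro eventually_conj near y z mem) auto
    then obtain N where N: "f N \<in> kothe_space a" "kothe_seminorm a k (\<lambda>n. f N n - y n) < e / 2"
      "kothe_seminorm a k (\<lambda>n. f N n - z n) < e / 2"
      using eventually_happens'[OF sequentially_bot] by blast
    have "norm (y n - z n) * a n k \<le> kothe_seminorm a k (\<lambda>n. y n - z n)"
      by (rule kothe_seminorm_component_le[OF a kothe_space_diff[OF a mem]])
    also have "\<dots> \<le> kothe_seminorm a k (\<lambda>n. y n - f N n) + kothe_seminorm a k (\<lambda>n. f N n - z n)"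
      by (rule kothe_seminorm_triangle_diff[OF a mem(1) N(1) mem(2)])
    finally show ?thesis
      using N kothe_seminorm_minus_commute[of a k y "f N"] by simp
  qed
  then have "norm (y n - z n) * a n k \<le> 0"
    using field_le_epsilon[of "norm (y n - z n) * a n k" 0] by simp
  then show "y n = z n"
    using k by (simp add: mult_le_0_iff)
qed

section \<open>Operators given by a matrix\<close>

text \<open>The sum is taken coordinate by coordinate, which avoids the topology of the target;
  \<open>limitin_matrix_operator\<close> shows that it is also the limit there.\<close>

definition matrix_operator :: "(nat \<Rightarrow> nat \<Rightarrow> 'a) \<Rightarrow> (nat \<Rightarrow> 'a) \<Rightarrow> nat \<Rightarrow> 'a::{real_normed_field,banach}"
  where "matrix_operator c x = (\<lambda>j. \<Sum>n. x n * c n j)"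

text \<open>The \<open>m\<close>-th seminorm of the \<open>n\<close>-th unit vector is
  \<open>a n m\<close>, so this is a continuity estimate tested on unit vectors, with
  \<open>m\<close> and \<open>D\<close> uniform in \<open>n\<close>. The sign of \<open>D\<close>
  allows seminorm inequalities to be multiplied by it.\<close>

definition columns_dominated ::
    "(nat \<Rightarrow> nat \<Rightarrow> real) \<Rightarrow> (nat \<Rightarrow> nat \<Rightarrow> real) \<Rightarrow> (nat \<Rightarrow> nat \<Rightarrow> 'a::{real_normed_field,banach}) \<Rightarrow> bool"
  where "columns_dominated a b c \<longleftrightarrow> (\<forall>n. c n \<in> kothe_space b) \<and>
    (\<forall>k. \<exists>m D. 0 \<le> D \<and> (\<forall>n. kothe_seminorm b k (c n) \<le> D * a n m))"

lemma matrix_operator_summable_norm: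
  assumes b: "kothe_matrix b" and c: "columns_dominated a b c" and x: "x \<in> kothe_space a"
  shows "summable (\<lambda>n. norm (x n * c n j))"
proof -
  \<comment> \<open>A seminorm that sees the coordinate \<open>j\<close>; dividing by its weight
    turns the column estimate into a bound on \<open>c n j\<close>.\<close>
  obtain k where k: "0 < b j k"
    using b unfolding kothe_matrix_def by blast
  obtain m D where D: "\<And>n. kothe_seminorm b k (c n) \<le> D * a n m"
    using c unfolding columns_dominated_def by blast
  show ?thesis
  proof (rule summable_comparison_test')
    show "summable (\<lambda>n. D / b j k * (norm (x n) * a n m))"
      by (intro summable_mult kothe_space_summable x)
    fix n
    have "norm (c n j) * b j k \<le> D * a n m"
      using kothe_seminorm_component_le[OF b, of "c n" j k] D[of n] c
      by (auto simp: columns_dominated_def)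
    then have "norm (c n j) \<le> D * a n m / b j k"
      using k by (simp add: pos_le_divide_eq)
    from mult_left_mono[OF this, of "norm (x n)"]
    show "norm (norm (x n * c n j)) \<le> D / b j k * (norm (x n) * a n m)"
      by (simp add: norm_mult mult_ac)
  qed
qed

lemma matrix_operator_diff:
  assumes "kothe_matrix b" "columns_dominated a b c" "x \<in> kothe_space a" "y \<in> kothe_space a"
  shows "matrix_operator c (\<lambda>n. x n - y n) j = matrix_operator c x j - matrix_operator c y j"
  unfolding matrix_operator_def left_diff_distrib
  by (rule suminf_diff[symmetric])
    (rule summable_norm_cancel[OF matrix_operator_summable_norm[OF assms(1,2)]], fact)+

text \<open>Cutting the sum over \<open>j\<close> at \<open>J\<close> makes the exchange with the
  series over \<open>n\<close> a matter of finite additivity. The bound is independent of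
  \<open>J\<close>, so it yields both summability over \<open>j\<close> and the estimate for the
  full seminorm.\<close>

lemma matrix_operator_partial_sum_le:
  assumes b: "kothe_matrix b" and c: "columns_dominated a b c" and x: "x \<in> kothe_space a"
    and D: "\<And>n. kothe_seminorm b k (c n) \<le> D * a n m"
  shows "(\<Sum>j<J. norm (matrix_operator c x j) * b j k) \<le> D * kothe_seminorm a m x"
proof -
  note sm = matrix_operator_summable_norm[OF b c x]
  have "(\<Sum>j<J. norm (matrix_operator c x j) * b j k) \<le> (\<Sum>j<J. (\<Sum>n. norm (x n * c n j)) * b j k)"
    unfolding matrix_operator_def
    by (intro sum_mono mult_right_mono summable_norm sm kothe_matrix_nonneg b)
  also have "\<dots> = (\<Sum>j<J. \<Sum>n. norm (x n * c n j) * b j k)"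
    by (simp add: suminf_mult2 sm)
  also have "\<dots> = (\<Sum>n. \<Sum>j<J. norm (x n * c n j) * b j k)"
    by (rule suminf_sum[symmetric]) (intro summable_mult2 sm)
  also have "\<dots> \<le> (\<Sum>n. D * (norm (x n) * a n m))"
  proof (rule suminf_le)
    show "summable (\<lambda>n. \<Sum>j<J. norm (x n * c n j) * b j k)"
      by (intro summable_sum summable_mult2 sm)
    show "summable (\<lambda>n. D * (norm (x n) * a n m))"
      by (intro summable_mult kothe_space_summable x)
    fix n
    have "(\<Sum>j<J. norm (c n j) * b j k) \<le> kothe_seminorm b k (c n)"
      unfolding kothe_seminorm_def using c b
      by (intro sum_le_suminf kothe_space_summable)
        (auto simp: columns_dominated_def kothe_matrix_nonneg)
    also have "\<dots> \<le> D * a n m"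
      by (rule D)
    finally have "norm (x n) * (\<Sum>j<J. norm (c n j) * b j k) \<le> norm (x n) * (D * a n m)"
      by (rule mult_left_mono) simp
    then show "(\<Sum>j<J. norm (x n * c n j) * b j k) \<le> D * (norm (x n) * a n m)"
      by (simp add: norm_mult sum_distrib_left mult_ac)
  qed
  also have "\<dots> = D * kothe_seminorm a m x"
    unfolding kothe_seminorm_def by (intro suminf_mult kothe_space_summable x)
  finally show ?thesis .
qed

lemma matrix_operator_in_kothe_space:
  assumes "kothe_matrix b" "columns_dominated a b c" "x \<in> kothe_space a"
  shows "matrix_operator c x \<in> kothe_space b"
  unfolding kothe_space_def
proof (intro CollectI allI)
  fix k
  obtain m D where "\<And>n. kothe_seminorm b k (c n) \<le> D * a n m"
    using assms(2) unfolding columns_dominated_def by blast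
  from matrix_operator_partial_sum_le[OF assms this]
  show "summable (\<lambda>j. norm (matrix_operator c x j) * b j k)"
    using assms(1) by (intro summableI_nonneg_bounded) (auto simp: kothe_matrix_nonneg)
qed

lemma kothe_seminorm_matrix_operator_le:
  assumes "kothe_matrix b" "columns_dominated a b c" "x \<in> kothe_space a"
    and "\<And>n. kothe_seminorm b k (c n) \<le> D * a n m"
  shows "kothe_seminorm b k (matrix_operator c x) \<le> D * kothe_seminorm a m x"
  unfolding kothe_seminorm_def[of b]
  by (intro suminf_le_const kothe_space_summable matrix_operator_in_kothe_space[OF assms(1-3)]
      matrix_operator_partial_sum_le[OF assms])

text \<open>The error of a partial sum is the operator applied to a tail of \<open>x\<close>, and
  the seminorms of these tails tend to \<open>0\<close>.\<close>

lemma limitin_matrix_operator: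
  assumes b: "kothe_matrix b" and c: "columns_dominated a b c" and x: "x \<in> kothe_space a"
  shows "limitin (kothe_topology b) (\<lambda>N j. \<Sum>n<N. x n * c n j) (matrix_operator c x) sequentially"
proof (rule limitin_kothe_topologyI[OF b matrix_operator_in_kothe_space[OF b c x]])
  show S: "(\<lambda>j. \<Sum>n<N. x n * c n j) \<in> kothe_space b" for N
    using c by (intro kothe_space_sum[OF b] kothe_space_scale) (auto simp: columns_dominated_def)
  fix k
  obtain m D where D: "0 \<le> D" "\<And>n. kothe_seminorm b k (c n) \<le> D * a n m"
    using c unfolding columns_dominated_def by blast
  \<comment> \<open>The tail keeps its positions and only has its first \<open>N\<close> entries
    erased, so that each remaining entry still meets its own weight and column.\<close>
  let ?t = "\<lambda>N n. if n < N then 0 else x n"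
  have sum_t: "(\<lambda>n. norm (?t N n) * a n l) sums
      (kothe_seminorm a l x - (\<Sum>n<N. norm (x n) * a n l))" for N l
  proof -
    \<comment> \<open>The erased part is subtracted as a finitely supported series.\<close>
    have "(\<lambda>n. norm (x n) * a n l - (if n \<in> {..<N} then norm (x n) * a n l else 0)) sums
        (kothe_seminorm a l x - (\<Sum>n<N. norm (x n) * a n l))"
      unfolding kothe_seminorm_def
      by (intro sums_diff summable_sums kothe_space_summable x sums_If_finite_set) auto
    then show ?thesis
      by (rule sums_cong[THEN iffD1, rotated]) auto
  qed
  have t: "?t N \<in> kothe_space a" for N
    using sum_t by (auto simp: kothe_space_def intro: sums_summable)
  have tail: "matrix_operator c x j - (\<Sum>n<N. x n * c n j) = matrix_operator c (?t N) j" for N j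
  proof -
    have "(\<lambda>n. x n * c n j - (if n \<in> {..<N} then x n * c n j else 0)) sums
        (matrix_operator c x j - (\<Sum>n<N. x n * c n j))"
      unfolding matrix_operator_def
      by (intro sums_diff summable_sums sums_If_finite_set
          summable_norm_cancel[OF matrix_operator_summable_norm[OF b c x]]) auto
    then have "(\<lambda>n. ?t N n * c n j) sums (matrix_operator c x j - (\<Sum>n<N. x n * c n j))"
      by (rule sums_cong[THEN iffD1, rotated]) auto
    then show ?thesis
      unfolding matrix_operator_def by (simp add: sums_unique)
  qed
  show "(\<lambda>N. kothe_seminorm b k (\<lambda>j. (\<Sum>n<N. x n * c n j) - matrix_operator c x j)) \<longlonglongrightarrow> 0"
  proof (rule tendsto_sandwich)
    show "\<forall>\<^sub>F N in sequentially.
        0 \<le> kothe_seminorm b k (\<lambda>j. (\<Sum>n<N. x n * c n j) - matrix_operator c x j)"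
      by (intro always_eventually allI kothe_seminorm_nonneg[OF b] kothe_space_diff[OF b] S
          matrix_operator_in_kothe_space[OF b c x])
    show "\<forall>\<^sub>F N in sequentially.
        kothe_seminorm b k (\<lambda>j. (\<Sum>n<N. x n * c n j) - matrix_operator c x j)
          \<le> D * (kothe_seminorm a m x - (\<Sum>n<N. norm (x n) * a n m))"
    proof (intro always_eventually allI)
      fix N
      have "kothe_seminorm b k (\<lambda>j. (\<Sum>n<N. x n * c n j) - matrix_operator c x j)
          = kothe_seminorm b k (matrix_operator c (?t N))"
        by (simp add: kothe_seminorm_minus_commute[of b k "\<lambda>j. \<Sum>n<N. x n * c n j"] tail)
      also have "\<dots> \<le> D * kothe_seminorm a m (?t N)"
        by (rule kothe_seminorm_matrix_operator_le[OF b c t D(2)])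
      also have "kothe_seminorm a m (?t N) = kothe_seminorm a m x - (\<Sum>n<N. norm (x n) * a n m)"
        using sums_unique[OF sum_t] by (simp add: kothe_seminorm_def)
      finally show "kothe_seminorm b k (\<lambda>j. (\<Sum>n<N. x n * c n j) - matrix_operator c x j)
          \<le> D * (kothe_seminorm a m x - (\<Sum>n<N. norm (x n) * a n m))" .
    qed
    have "(\<lambda>N. \<Sum>n<N. norm (x n) * a n m) \<longlonglongrightarrow> kothe_seminorm a m x"
      unfolding kothe_seminorm_def by (intro summable_LIMSEQ kothe_space_summable x)
    from tendsto_mult_left[OF tendsto_diff[OF tendsto_const[of "kothe_seminorm a m x"] this], of D]
    show "(\<lambda>N. D * (kothe_seminorm a m x - (\<Sum>n<N. norm (x n) * a n m))) \<longlonglongrightarrow> 0"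
      by simp
  qed auto
qed

text \<open>It suffices to pull back subbasic balls. Around each point of such a preimage, linearity
  and the seminorm estimate give a ball of the \<open>m\<close>-th seminorm inside it.\<close>

lemma continuous_map_matrix_operator:
  fixes c :: "nat \<Rightarrow> nat \<Rightarrow> 'a::{real_normed_field,banach}"
  assumes a: "kothe_matrix a" and b: "kothe_matrix b" and c: "columns_dominated a b c"
  shows "continuous_map (kothe_topology a) (kothe_topology b) (matrix_operator c)"
  unfolding kothe_topology_def[of b]
proof (rule continuous_on_generated_topo)
  note mem = matrix_operator_in_kothe_space[OF b c]
  \<comment> \<open>The union of the subbasic balls is the whole space
    \<open>kothe_space b\<close>.\<close>
  show "matrix_operator c ` topspace (kothe_topology a) \<subseteq>
      \<Union>{{y \<in> kothe_space b. kothe_seminorm b k (\<lambda>n. y n - x n) < r} | x k r.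
        x \<in> kothe_space b \<and> 0 < r}"
    using mem topspace_kothe_topology[of b, unfolded kothe_topology_def topology_generated_by_topspace]
    by (simp only: topspace_kothe_topology) blast
  fix U
  assume "U \<in> {{y \<in> kothe_space b. kothe_seminorm b k (\<lambda>n. y n - x n) < r} | x k r.
        (x::nat \<Rightarrow> 'a) \<in> kothe_space b \<and> 0 < r}"
  then obtain z k r where U: "U = {y \<in> kothe_space b. kothe_seminorm b k (\<lambda>n. y n - z n) < r}"
    and z: "z \<in> kothe_space b"
    by blast
  obtain m D where D: "0 \<le> D" "\<And>n. kothe_seminorm b k (c n) \<le> D * a n m"
    using c unfolding columns_dominated_def by blast
  show "openin (kothe_topology a) (matrix_operator c -` U \<inter> topspace (kothe_topology a))"
  proof (subst openin_subopen, intro ballI)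
    fix x
    assume "x \<in> matrix_operator c -` U \<inter> topspace (kothe_topology a)"
    then have x: "x \<in> kothe_space a"
      and xr: "kothe_seminorm b k (\<lambda>n. matrix_operator c x n - z n) < r"
      by (auto simp: U topspace_kothe_topology)
    \<comment> \<open>The remaining room in the target ball, divided by \<open>D + 1\<close>: this
      is positive even for \<open>D = 0\<close> and makes \<open>D * e\<close> strictly smaller than
      that room.\<close>
    define e where "e = (r - kothe_seminorm b k (\<lambda>n. matrix_operator c x n - z n)) / (D + 1)"
    have e: "0 < e"
      using xr D by (simp add: e_def)
    let ?B = "{y \<in> kothe_space a. kothe_seminorm a m (\<lambda>n. y n - x n) < e}"
    have "y \<in> matrix_operator c -` U" if "y \<in> ?B" for y
    proof -
      have y: "y \<in> kothe_space a" and ye: "kothe_seminorm a m (\<lambda>n. y n - x n) < e"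
        using that by auto
      have yx: "(\<lambda>n. y n - x n) \<in> kothe_space a"
        by (rule kothe_space_diff[OF a y x])
      have "kothe_seminorm b k (\<lambda>n. matrix_operator c y n - matrix_operator c x n)
          \<le> D * kothe_seminorm a m (\<lambda>n. y n - x n)"
        using kothe_seminorm_matrix_operator_le[OF b c yx D(2)]
        by (simp add: matrix_operator_diff[OF b c y x, symmetric])
      also have "\<dots> \<le> D * e"
        using ye D by (intro mult_left_mono) auto
      also have "\<dots> < (D + 1) * e"
        using e by simp
      also have "\<dots> = r - kothe_seminorm b k (\<lambda>n. matrix_operator c x n - z n)"
        using D by (simp add: e_def)
      finally show ?thesis
        using kothe_seminorm_triangle_diff[OF b mem[OF y] mem[OF x] z, of k] mem[OF y]
        by (simp add: U)
    qed
    moreover have "x \<in> ?B"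
      using x e by (simp add: kothe_seminorm_def)
    ultimately show "\<exists>T. openin (kothe_topology a) T \<and> x \<in> T \<and>
        T \<subseteq> matrix_operator c -` U \<inter> topspace (kothe_topology a)"
      using openin_kothe_ball[OF x e, of m] by (intro exI[of _ ?B]) (auto simp: topspace_kothe_topology)
  qed
qed

section \<open>Hankel operators into power series spaces\<close>

lemma kothe_matrix_power_series_matrix:
  assumes "\<forall>n. 0 \<le> \<beta> n"
  shows "kothe_matrix (power_series_matrix \<beta>)"
  using assms by (auto simp: kothe_matrix_def power_series_matrix_def intro!: mult_right_mono)

text \<open>Moving to the next seminorm of \<theta> gains one factor
  \<open>exp (\<beta> (j + n))\<close>, which is at least \<open>exp (\<beta> n)\<close>; this pays
  for the decay in \<open>n\<close>.\<close>

lemma hankel_column_seminorm_le: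
  assumes "\<forall>n. 0 \<le> \<beta> n" "mono \<beta>" "\<theta> \<in> kothe_space (power_series_matrix \<beta>)"
  shows "hankel_column \<theta> n \<in> kothe_space (power_series_matrix \<beta>)"
    and "kothe_seminorm (power_series_matrix \<beta>) k (hankel_column \<theta> n)
      \<le> exp (- \<beta> n) * kothe_seminorm (power_series_matrix \<beta>) (Suc k) \<theta>"
proof -
  let ?b = "power_series_matrix \<beta>"
  have le: "norm (hankel_column \<theta> n j) * ?b j k
      \<le> exp (- \<beta> n) * (norm (\<theta> (j + n)) * ?b (j + n) (Suc k))" for j k
  proof -
    \<comment> \<open>Added together, these bound
      \<open>real (Suc k) * \<beta> j + \<beta> n\<close> by
      \<open>real (Suc (Suc k)) * \<beta> (j + n)\<close>, the exponent at index
      \<open>Suc k\<close>.\<close>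
    have "real (Suc k) * \<beta> j \<le> real (Suc k) * \<beta> (j + n)" "\<beta> n \<le> \<beta> (j + n)"
      by (auto intro!: mult_left_mono monoD[OF assms(2)])
    then have "?b j k \<le> exp (- \<beta> n) * ?b (j + n) (Suc k)"
      unfolding power_series_matrix_def exp_add[symmetric] by (simp add: algebra_simps)
    from mult_left_mono[OF this, of "norm (\<theta> (j + n))"]
    show ?thesis
      by (simp add: hankel_column_def add.commute mult_ac)
  qed
  have sm: "summable (\<lambda>j. norm (\<theta> (j + n)) * ?b (j + n) k)" for k
    by (rule summable_ignore_initial_segment[OF kothe_space_summable[OF assms(3)]])
  have "summable (\<lambda>j. norm (hankel_column \<theta> n j) * ?b j k)" for k
  proof (rule summable_comparison_test')
    show "summable (\<lambda>j. exp (- \<beta> n) * (norm (\<theta> (j + n)) * ?b (j + n) (Suc k)))"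
      by (intro summable_mult sm)
    show "norm (norm (hankel_column \<theta> n j) * ?b j k)
        \<le> exp (- \<beta> n) * (norm (\<theta> (j + n)) * ?b (j + n) (Suc k))" for j
      using le[of j k] by (simp add: power_series_matrix_def)
  qed
  then show col: "hankel_column \<theta> n \<in> kothe_space ?b"
    by (simp add: kothe_space_def)
  have "kothe_seminorm ?b k (hankel_column \<theta> n)
      \<le> (\<Sum>j. exp (- \<beta> n) * (norm (\<theta> (j + n)) * ?b (j + n) (Suc k)))"
    unfolding kothe_seminorm_def
    by (intro suminf_le le kothe_space_summable col summable_mult sm)
  also have "\<dots> = exp (- \<beta> n) * (\<Sum>j. norm (\<theta> (j + n)) * ?b (j + n) (Suc k))"
    by (intro suminf_mult sm)
  \<comment> \<open>The shifted series is the seminorm series of \<theta> without its first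
    \<open>n\<close> terms, which are non-negative.\<close>
  also have "\<dots> \<le> exp (- \<beta> n) * kothe_seminorm ?b (Suc k) \<theta>"
    using suminf_split_initial_segment[OF kothe_space_summable[OF assms(3)], of "Suc k" n]
    by (auto simp: kothe_seminorm_def power_series_matrix_def intro!: sum_nonneg)
  finally show "kothe_seminorm ?b k (hankel_column \<theta> n) \<le> exp (- \<beta> n) * kothe_seminorm ?b (Suc k) \<theta>" .
qed

theorem proposition3p6:
  fixes a :: "nat \<Rightarrow> nat \<Rightarrow> real"
    and \<beta> :: "nat \<Rightarrow> real"
    and \<theta> :: "nat \<Rightarrow> 'a::{real_normed_field,banach}"
  assumes "kothe_matrix a"
    and "\<forall>n. 0 \<le> \<beta> n"
    and "mono \<beta>"
    and "filterlim \<beta> at_top sequentially"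
    and "\<theta> \<in> kothe_space (power_series_matrix \<beta>)"
    and "\<forall>k. \<exists>m C. 0 < C \<and> (\<forall>n. exp (- real (Suc k) * \<beta> n) \<le> C * a n m)"
  shows "hankel_well_defined a (power_series_matrix \<beta>) \<theta> \<and>
    continuous_map (kothe_topology a) (kothe_topology (power_series_matrix \<beta>))
      (hankel_operator (power_series_matrix \<beta>) \<theta>)"
proof -
  let ?b = "power_series_matrix \<beta>" and ?c = "hankel_column \<theta>"
  note b = kothe_matrix_power_series_matrix[OF assms(2)]
  note col = hankel_column_seminorm_le[OF assms(2,3,5)]
  \<comment> \<open>Index \<open>0\<close> stands for the exponent \<open>1\<close>, matching the
    factor \<open>exp (- \<beta> n)\<close> of the column estimate.\<close>
  from assms(6)[rule_format, of 0] obtain m C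
    where C: "0 < C" "\<And>n. exp (- \<beta> n) \<le> C * a n m"
    by auto
  have c: "columns_dominated a ?b ?c"
    unfolding columns_dominated_def
  proof (intro conjI allI exI)
    fix k n
    let ?t = "kothe_seminorm ?b (Suc k) \<theta>"
    have t: "0 \<le> ?t"
      by (rule kothe_seminorm_nonneg[OF b assms(5)])
    \<comment> \<open>The constant of the column estimate: it depends on \<open>k\<close> through
      \<open>?t\<close>, while \<open>m\<close> stays fixed.\<close>
    show "0 \<le> C * ?t"
      using C t by simp
    have "kothe_seminorm ?b k (?c n) \<le> exp (- \<beta> n) * ?t"
      by (rule col)
    also have "\<dots> \<le> C * a n m * ?t"
      by (intro mult_right_mono C t)
    finally show "kothe_seminorm ?b k (?c n) \<le> C * ?t * a n m"
      by (simp add: mult_ac)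
  qed (rule col)
  have lim: "limitin (kothe_topology ?b) (hankel_partial_sum \<theta> x) (matrix_operator ?c x) sequentially"
    if "x \<in> kothe_space a" for x
    using limitin_matrix_operator[OF b c that] by (simp add: hankel_partial_sum_def[abs_def])
  \<comment> \<open>Uniqueness of limits resolves the definite description. The two operators are
    compared only on \<open>kothe_space a\<close>, the carrier of the source topology, which is
    enough to transfer continuity.\<close>
  have "hankel_operator ?b \<theta> x = matrix_operator ?c x" if "x \<in> kothe_space a" for x
    unfolding hankel_operator_def
    by (rule the_equality) (use lim[OF that] limitin_kothe_topology_unique[OF b] in blast)+
  then have "continuous_map (kothe_topology a) (kothe_topology ?b) (hankel_operator ?b \<theta>)"
    by (intro continuous_map_eq[OF continuous_map_matrix_operator[OF assms(1) b c]])
      (simp add: topspace_kothe_topology)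
  then show ?thesis
    using col(1) lim by (auto simp: hankel_well_defined_def)
qed

end
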